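(* Let $\varphi$ be real with $\sin\frac{\varphi}{2}\neq 0$, which means $b\neq 0$ and $\varphi\neq 2n\pi$ ($n$ an integer), where $b=\sin\frac{\varphi}{2}$ is the coefficient defined in the context. Then, with $\xi_0$ denoting the constant of integration (a constant that may be suitably chosen), $$u(\xi)=4\tan^{-1}\left\{\frac{1}{\left|\sin\frac{\varphi}{2}\right|}\tanh\left[\frac{1}{4}(\xi+\xi_0)\right]+\frac{\cos\frac{\varphi}{2}}{\sin\frac{\varphi}{2}}\right\}=-\varphi+4\tan^{-1}\left(e^{\xi/2}\right).$$
   Context: The function $u(\xi)$ is a solution of the first-order equation $u'(\xi)=a\sin\frac{u}{2}+b\cos\frac{u}{2}$ with $a=\cos\frac{\varphi}{2}$, $b=\sin\frac{\varphi}{2}$ (normalized so that $a^2+b^2=1$). Such a $u$ is a travelling-wave solution of a sine-Gordon equation with constant phase $\varphi$. The constant $\xi_0$ arises on integrating this first-order equation. Here $\tan^{-1}$ denotes the inverse tangent, and expressions $4\tan^{-1}(\cdot)$ are regarded as having period $4\pi$, i.e. as defined modulo $4\pi$.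
   Formalization: The stated equality of the two forms mod 4π fails whenever sin(φ/2)<0 (e.g. φ=−π); there the formal statement says instead that the inverse-tangent-of-tanh form equals u+2π, with u=−φ+4tan⁻¹(e^{ξ/2}) mod 4π; for sin(φ/2)>0 it is as stated. *)

theory Defs
  imports "HOL-Analysis.Analysis" "HOL-Library.Real_Mod"
begin

definition travelling_wave_solution :: "real \<Rightarrow> (real \<Rightarrow> real) \<Rightarrow> bool" where
  "travelling_wave_solution \<phi> u \<longleftrightarrow>
     (\<forall>\<xi>. (u has_real_derivative
             cos (\<phi> / 2) * sin (u \<xi> / 2) + sin (\<phi> / 2) * cos (u \<xi> / 2)) (at \<xi>))"

definition tanh_form :: "real \<Rightarrow> real \<Rightarrow> real \<Rightarrow> real" where
  "tanh_form \<phi> \<xi>0 \<xi> =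
     4 * arctan (1 / \<bar>sin (\<phi> / 2)\<bar> * tanh (1 / 4 * (\<xi> + \<xi>0)) + cos (\<phi> / 2) / sin (\<phi> / 2))"

definition exp_form :: "real \<Rightarrow> real \<Rightarrow> real" where
  "exp_form \<phi> \<xi> = - \<phi> + 4 * arctan (exp (\<xi> / 2))"

text \<open>
  Values of four times the inverse tangent are only defined modulo \<open>4 * pi\<close>, so equations
  between them are congruences modulo \<open>4 * pi\<close>.

  The two forms are congruent, for a suitable \<open>\<xi>0\<close>, exactly if \<open>sin (\<phi> / 2) > 0\<close>.
  If \<open>sin (\<phi> / 2) < 0\<close>, they differ by the half period \<open>2 * pi\<close>: for \<open>\<phi> = - pi\<close>,
  as \<open>\<xi>\<close> tends to minus infinity, the first one tends to \<open>- pi\<close> and the second one to \<open>pi\<close>,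
  for every real constant \<open>\<xi>0\<close>. This is because the first form depends on \<open>\<phi>\<close> only
  modulo \<open>2 * pi\<close>, whereas the second one and the differential equation do not.
\<close>

end

theory Submission
  imports Defs
begin

text \<open>
  With \<open>E = exp (\<xi> / 2)\<close> one has \<open>sin (2 * arctan E) = 2 * E / (1 + E\<^sup>2)\<close>, so \<open>exp_form \<phi>\<close> solves
  \<open>u' = sin (u / 2 + \<phi> / 2)\<close>, which is the given equation. The remaining claims compare
  tangents at a quarter of the angle: with \<open>t = tan (\<phi> / 4)\<close> the argument of the inverse tangent
  in the other form becomes \<open>(E - t) / (1 + E * t) = tan (arctan E - \<phi> / 4)\<close> when \<open>t > 0\<close> and
  \<open>\<xi>0 = 2 * ln t\<close>, and the negative of its reciprocal when \<open>t < 0\<close> and \<open>\<xi>0 = - 2 * ln (- t)\<close>.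
\<close>

text \<open>The hypothesis is \<open>tan x = y\<close> freed of its denominator. It makes
  \<open>sin (x - arctan y)\<close> vanish, so the two angles differ by a multiple of
  \<open>pi\<close>, which the factor 4 turns into the period.\<close>

lemma rcong_4_arctan:
  fixes x y :: real
  assumes "sin x = y * cos x"
  shows "[4 * x = 4 * arctan y] (rmod (4 * pi))"
proof -
  have "sin (x - arctan y) = 0"
    using assms by (simp add: sin_diff sin_arctan cos_arctan)
  then obtain i :: int where "x - arctan y = of_int i * pi"
    using sin_zero_iff_int2 by blast
  then have "4 * arctan y = 4 * x + of_int (- i) * (4 * pi)"
    by (simp add: algebra_simps)
  then show ?thesis
    unfolding rcong_altdef by blast
qed

text \<open>Twice the argument of \<open>tanh\<close> is \<open>\<xi> / 2 + ln r\<close>, so the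
  shift \<open>2 * ln r\<close> becomes the factor \<open>r\<close> in front of the
  exponential.\<close>

lemma tanh_quarter_shift:
  fixes \<xi> r :: real
  assumes "r > 0"
  shows "tanh (1 / 4 * (\<xi> + 2 * ln r)) = (r * exp (\<xi> / 2) - 1) / (r * exp (\<xi> / 2) + 1)"
proof -
  define F where "F = r * exp (\<xi> / 2)"
  have F: "F > 0"
    using assms by (simp add: F_def)
  have "exp (- 2 * (1 / 4 * (\<xi> + 2 * ln r))) = exp (- (ln r + \<xi> / 2))"
    by (rule arg_cong[of _ _ exp]) simp
  also have "\<dots> = inverse F"
    unfolding exp_minus exp_add F_def using assms by simp
  finally have "tanh (1 / 4 * (\<xi> + 2 * ln r)) = (1 - inverse F) / (1 + inverse F)"
    by (simp only: tanh_real_altdef)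
  also have "\<dots> = (F - 1) / (F + 1)"
    using F by (simp add: divide_simps add_pos_pos)
  finally show ?thesis
    by (simp only: F_def)
qed

text \<open>The value of \<open>d\<close> is \<open>sqrt (1 + E\<^sup>2)\<close>, but only its
  positivity matters: it cancels in the quotient of sine and cosine.\<close>

lemma sin_cos_arctan_diff:
  fixes E \<theta> :: real
  obtains d where "d > 0" "sin (arctan E - \<theta>) = (E * cos \<theta> - sin \<theta>) / d"
    "cos (arctan E - \<theta>) = (cos \<theta> + E * sin \<theta>) / d"
proof
  show "sqrt (1 + E\<^sup>2) > 0"
    by (simp add: add_pos_nonneg)
qed (simp_all add: sin_diff cos_diff sin_arctan cos_arctan add_divide_distrib diff_divide_distrib)

lemma travelling_wave_solution_exp_form: "travelling_wave_solution \<phi> (exp_form \<phi>)"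
  unfolding travelling_wave_solution_def
proof
  fix \<xi> :: real
  define E where "E = exp (\<xi> / 2 :: real)"
  have E: "1 + E\<^sup>2 > 0"
    by (simp add: add_pos_nonneg)
  have "cos (\<phi> / 2) * sin (exp_form \<phi> \<xi> / 2) + sin (\<phi> / 2) * cos (exp_form \<phi> \<xi> / 2)
    = sin (exp_form \<phi> \<xi> / 2 + \<phi> / 2)"
    by (simp add: sin_add)
  also have "exp_form \<phi> \<xi> / 2 + \<phi> / 2 = 2 * arctan E"
    by (simp add: exp_form_def E_def field_simps)
  also have "sin (2 * arctan E) = 2 * E / (1 + E\<^sup>2)"
    using E by (simp add: sin_double sin_arctan cos_arctan power2_eq_square)
  finally have *: "cos (\<phi> / 2) * sin (exp_form \<phi> \<xi> / 2) + sin (\<phi> / 2) * cos (exp_form \<phi> \<xi> / 2)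
    = 2 * E / (1 + E\<^sup>2)" .
  show "(exp_form \<phi> has_real_derivative
      cos (\<phi> / 2) * sin (exp_form \<phi> \<xi> / 2) + sin (\<phi> / 2) * cos (exp_form \<phi> \<xi> / 2)) (at \<xi>)"
    \<comment> \<open>The right-hand side is now free of \<open>\<phi>\<close>, and the chain rule
      gives the same value as \<open>4 * (E / 2) / (1 + E\<^sup>2)\<close>.\<close>
    unfolding * unfolding exp_form_def[abs_def]
    using E by (auto intro!: derivative_eq_intros simp: E_def divide_simps)
qed

lemma half_angle_quarter:
  fixes \<phi> :: real
  shows "sin (\<phi> / 2) = 2 * sin (\<phi> / 4) * cos (\<phi> / 4)"
    and "cos (\<phi> / 2) = (cos (\<phi> / 4))\<^sup>2 - (sin (\<phi> / 4))\<^sup>2"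
  using sin_double[of "\<phi> / 4"] cos_double[of "\<phi> / 4"] by simp_all

lemma tanh_form_pos:
  assumes "sin (\<phi> / 2) > 0"
  shows "[exp_form \<phi> \<xi> = tanh_form \<phi> (2 * ln (tan (\<phi> / 4))) \<xi>] (rmod (4 * pi))"
proof -
  define s c E where "s = sin (\<phi> / 4)" and "c = cos (\<phi> / 4)" and "E = exp (\<xi> / 2)"
  have E: "E > 0"
    by (simp add: E_def)
  have sc: "s * c > 0"
    using assms by (simp add: half_angle_quarter s_def c_def mult.commute)
  then have nz: "s \<noteq> 0" "c \<noteq> 0"
    by auto
  have t: "tan (\<phi> / 4) = s / c" "s / c > 0"
    using sc by (auto simp: tan_def s_def c_def zero_less_mult_iff zero_less_divide_iff)
  have "c + s * E \<noteq> 0"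
  proof -
    \<comment> \<open>Only the sign of \<open>s * c\<close> is known, not those of \<open>s\<close>
      and \<open>c\<close>; the extra factor \<open>c\<close> brings in this product.\<close>
    have "c * (c + s * E) = c\<^sup>2 + s * c * E"
      by (simp add: algebra_simps power2_eq_square)
    also have "\<dots> > 0"
      using sc E by (intro add_nonneg_pos) auto
    finally show ?thesis
      by auto
  qed
  moreover have "s\<^sup>2 + c\<^sup>2 = 1"
    by (simp add: s_def c_def)
  moreover have "tanh (1 / 4 * (\<xi> + 2 * ln (s / c))) = (s * E - c) / (s * E + c)"
    using tanh_quarter_shift[OF t(2), of \<xi>] nz
    by (simp add: E_def[symmetric] divide_simps)
  \<comment> \<open>The absolute value is \<open>2 * s * c\<close>. After clearing denominators, a
    polynomial identity remains that follows from \<open>s\<^sup>2 + c\<^sup>2 = 1\<close>.\<close>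
  ultimately have arg: "1 / \<bar>sin (\<phi> / 2)\<bar> * tanh (1 / 4 * (\<xi> + 2 * ln (s / c)))
      + cos (\<phi> / 2) / sin (\<phi> / 2) = (E * c - s) / (c + E * s)"
    using nz sc assms
    by (simp add: half_angle_quarter s_def[symmetric] c_def[symmetric] divide_simps) algebra
  obtain d where "d > 0" "sin (arctan E - \<phi> / 4) = (E * c - s) / d"
    "cos (arctan E - \<phi> / 4) = (c + E * s) / d"
    unfolding s_def c_def by (rule sin_cos_arctan_diff)
  then have "sin (arctan E - \<phi> / 4) = (E * c - s) / (c + E * s) * cos (arctan E - \<phi> / 4)"
    using \<open>c + s * E \<noteq> 0\<close> by (simp add: mult.commute)
  from rcong_4_arctan[OF this] show ?thesis
    unfolding tanh_form_def exp_form_def t arg by (simp add: E_def algebra_simps)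
qed

text \<open>A negative reciprocal of a tangent is the tangent of the angle advanced by
  \<open>pi / 2\<close>; the factor 4 makes this the offset \<open>2 * pi\<close>. As
  \<open>tan (\<phi> / 4)\<close> is negative, \<open>- cot (\<phi> / 4)\<close> is a legitimate
  argument of \<open>ln\<close>.\<close>

lemma tanh_form_neg:
  assumes "sin (\<phi> / 2) < 0"
  shows "[exp_form \<phi> \<xi> + 2 * pi = tanh_form \<phi> (2 * ln (- cot (\<phi> / 4))) \<xi>] (rmod (4 * pi))"
proof -
  define s c E where "s = sin (\<phi> / 4)" and "c = cos (\<phi> / 4)" and "E = exp (\<xi> / 2)"
  have E: "E > 0"
    by (simp add: E_def)
  have sc: "s * c < 0"
    using assms by (simp add: half_angle_quarter s_def c_def mult.commute)
  then have nz: "s \<noteq> 0" "c \<noteq> 0"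
    by auto
  have t: "- cot (\<phi> / 4) = - c / s" "- c / s > 0"
    using sc by (auto simp: cot_def s_def c_def mult_less_0_iff zero_less_divide_iff divide_less_0_iff)
  have "s - c * E \<noteq> 0"
  proof -
    have "s * (s - c * E) = s\<^sup>2 - s * c * E"
      by (simp add: algebra_simps power2_eq_square)
    also have "\<dots> > 0"
      using sc E mult_neg_pos[OF sc E] zero_le_power2[of s] by linarith
    finally show ?thesis
      by auto
  qed
  moreover have "s\<^sup>2 + c\<^sup>2 = 1"
    by (simp add: s_def c_def)
  moreover have "tanh (1 / 4 * (\<xi> + 2 * ln (- c / s))) = (- c * E - s) / (- c * E + s)"
    using tanh_quarter_shift[OF t(2), of \<xi>] nz
    by (simp add: E_def[symmetric] divide_simps)
  \<comment> \<open>Here the absolute value is \<open>- 2 * s * c\<close>, and this sign is what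
    produces the reciprocal.\<close>
  ultimately have arg: "1 / \<bar>sin (\<phi> / 2)\<bar> * tanh (1 / 4 * (\<xi> + 2 * ln (- c / s)))
      + cos (\<phi> / 2) / sin (\<phi> / 2) = (c + E * s) / (s - E * c)"
    using nz sc assms
    by (simp add: half_angle_quarter s_def[symmetric] c_def[symmetric] divide_simps) algebra
  obtain d where "d > 0" and d: "sin (arctan E - \<phi> / 4) = (E * c - s) / d"
    "cos (arctan E - \<phi> / 4) = (c + E * s) / d"
    unfolding s_def c_def by (rule sin_cos_arctan_diff)
  \<comment> \<open>The quarter turn replaces sine by cosine and cosine by minus sine, so both sides
    equal \<open>(c + E * s) / d\<close>.\<close>
  have "sin (arctan E - \<phi> / 4 + pi / 2)
      = (c + E * s) / (s - E * c) * cos (arctan E - \<phi> / 4 + pi / 2)"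
    using \<open>s - c * E \<noteq> 0\<close> \<open>d > 0\<close>
    unfolding sin_add cos_add d by (simp add: divide_simps) algebra
  from rcong_4_arctan[OF this] show ?thesis
    unfolding tanh_form_def exp_form_def t arg by (simp add: E_def algebra_simps)
qed

theorem lemma2:
  fixes \<phi> :: real
  assumes "sin (\<phi> / 2) \<noteq> 0"
  shows "\<exists>(u :: real \<Rightarrow> real) (\<xi>0 :: real). travelling_wave_solution \<phi> u \<and>
    (\<forall>\<xi>. [u \<xi> = exp_form \<phi> \<xi>] (rmod (4 * pi)) \<and>
         (sin (\<phi> / 2) > 0 \<longrightarrow> [u \<xi> = tanh_form \<phi> \<xi>0 \<xi>] (rmod (4 * pi))) \<and>
         (sin (\<phi> / 2) < 0 \<longrightarrow> [u \<xi> + 2 * pi = tanh_form \<phi> \<xi>0 \<xi>] (rmod (4 * pi))))"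
proof (cases "sin (\<phi> / 2) > 0")
  \<comment> \<open>The solution is \<open>exp_form \<phi>\<close> for either sign, which makes the
    first congruence reflexive; only the constant of integration depends on the sign.\<close>
  case True
  then show ?thesis
    using travelling_wave_solution_exp_form[of \<phi>] tanh_form_pos[OF True]
    by (intro exI[of _ "exp_form \<phi>"] exI[of _ "2 * ln (tan (\<phi> / 4))"]) auto
next
  case False
  with assms have "sin (\<phi> / 2) < 0"
    by simp
  then show ?thesis
    using travelling_wave_solution_exp_form[of \<phi>] tanh_form_neg
    by (intro exI[of _ "exp_form \<phi>"] exI[of _ "2 * ln (- cot (\<phi> / 4))"]) auto
qed

end
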